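(* Let $\Delta$ be a matroid complex on $[n]$ and $I=I_\Delta\subset S$. Then for every integer $m\ge 1$, the symbolic power $I^{(m)}$ is $0$-clean.
   Context: $S=K[x_1,\dots,x_n]$, $K$ a field. $I_\Delta$ is the Stanley–Reisner ideal of $\Delta$, generated by $\prod_{i\in F}x_i$ for $F\subseteq[n]$, $F\notin\Delta$. A matroid complex is a simplicial complex whose faces are the independent sets of a matroid on its vertex set. If $\Delta$ has facets $F_1,\dots,F_t$, then $I_\Delta=\bigcap_{i=1}^t P_{F_i^c}$ with $P_{F^c}=(x_j:j\notin F)$, and the $m$-th symbolic power is $I_\Delta^{(m)}=\bigcap_{i=1}^t P_{F_i^c}^m$. For a monomial $u=x_1^{a_1}\cdots x_n^{a_n}$, $\mathrm{supp}(u)=\{i:a_i>0\}$. For an ideal $I$, $\min(I)$ is the set of minimal primes of $I$. A monomial $u\neq 1$ with $u\notin I$ is a cleaner monomial of $I$ if $\min(I+Su)\subseteq\min(I)$. For $k\ge 0$, the class of $k$-clean monomial ideals is defined recursively (smallest class closed under the rule): a proper monomial ideal $I$ is $k$-clean if either $I$ is prime, or $I$ has no embedded primes and there is a cleaner monomial $u$ of $I$ with $|\mathrm{supp}(u)|\le k+1$ such that $I:u$ and $I+Su$ are $k$-clean. *)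

theory Defs
  imports "HOL-Library.Poly_Mapping"
begin

definition is_ideal :: "'r::comm_ring_1 set \<Rightarrow> bool" where
  "is_ideal I \<longleftrightarrow> 0 \<in> I \<and> (\<forall>a\<in>I. \<forall>b\<in>I. a + b \<in> I) \<and> (\<forall>a\<in>I. \<forall>r. r * a \<in> I)"

definition ideal_gen :: "'r::comm_ring_1 set \<Rightarrow> 'r set" where
  "ideal_gen A = \<Inter>{J. is_ideal J \<and> A \<subseteq> J}"

definition prime_ideal :: "'r::comm_ring_1 set \<Rightarrow> bool" where
  "prime_ideal P \<longleftrightarrow> is_ideal P \<and> P \<noteq> UNIV \<and> (\<forall>a b. a * b \<in> P \<longrightarrow> a \<in> P \<or> b \<in> P)"

definition ideal_sum :: "'r::comm_ring_1 set \<Rightarrow> 'r set \<Rightarrow> 'r set" where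
  "ideal_sum I J = {a + b | a b. a \<in> I \<and> b \<in> J}"

definition principal_ideal :: "'r::comm_ring_1 \<Rightarrow> 'r set" where
  "principal_ideal u = {g * u | g. True}"

definition colon_ideal :: "'r::comm_ring_1 set \<Rightarrow> 'r \<Rightarrow> 'r set" where
  "colon_ideal I u = {f. f * u \<in> I}"

definition ideal_power :: "'r::comm_ring_1 set \<Rightarrow> nat \<Rightarrow> 'r set" where
  "ideal_power P m = ideal_gen {prod_list xs | xs. length xs = m \<and> set xs \<subseteq> P}"

definition min_primes :: "'r::comm_ring_1 set \<Rightarrow> 'r set set" where
  "min_primes I = {P. prime_ideal P \<and> I \<subseteq> P \<and> (\<forall>Q. prime_ideal Q \<and> I \<subseteq> Q \<and> Q \<subseteq> P \<longrightarrow> Q = P)}"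

definition ass_primes :: "'r::comm_ring_1 set \<Rightarrow> 'r set set" where
  "ass_primes I = {P. prime_ideal P \<and> (\<exists>f. P = colon_ideal I f)}"

definition no_embedded_primes :: "'r::comm_ring_1 set \<Rightarrow> bool" where
  "no_embedded_primes I \<longleftrightarrow> ass_primes I \<subseteq> min_primes I"

text \<open>Variables are indexed by a finite type 'v (playing the role of [n], n = CARD('v)).
  Polynomials are finitely supported maps from exponent vectors to coefficients.\<close>

type_synonym ('v, 'k) mpoly = "('v \<Rightarrow>\<^sub>0 nat) \<Rightarrow>\<^sub>0 'k"

definition monom :: "('v \<Rightarrow>\<^sub>0 nat) \<Rightarrow> ('v, 'k::field) mpoly" where
  "monom a = Poly_Mapping.single a 1"

definition var :: "'v \<Rightarrow> ('v, 'k::field) mpoly" where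
  "var j = monom (Poly_Mapping.single j 1)"

definition supp :: "('v \<Rightarrow>\<^sub>0 nat) \<Rightarrow> 'v set" where
  "supp a = Poly_Mapping.keys a"

definition monomial_ideal :: "('v, 'k::field) mpoly set \<Rightarrow> bool" where
  "monomial_ideal I \<longleftrightarrow> (\<exists>M. I = ideal_gen (monom ` M))"

definition prime_compl :: "'v set \<Rightarrow> ('v, 'k::field) mpoly set" where
  "prime_compl F = ideal_gen (var ` (- F))"

definition matroid_complex :: "'v set set \<Rightarrow> bool" where
  "matroid_complex \<Delta> \<longleftrightarrow>
     {} \<in> \<Delta> \<and> (\<forall>F\<in>\<Delta>. finite F) \<and>
     (\<forall>F\<in>\<Delta>. \<forall>G. G \<subseteq> F \<longrightarrow> G \<in> \<Delta>) \<and>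
     (\<forall>A\<in>\<Delta>. \<forall>B\<in>\<Delta>. card A < card B \<longrightarrow> (\<exists>x\<in>B - A. insert x A \<in> \<Delta>))"

definition facets :: "'v set set \<Rightarrow> 'v set set" where
  "facets \<Delta> = {F\<in>\<Delta>. \<forall>G\<in>\<Delta>. F \<subseteq> G \<longrightarrow> G = F}"

definition stanley_reisner :: "'v set set \<Rightarrow> ('v, 'k::field) mpoly set" where
  "stanley_reisner \<Delta> = ideal_gen {(\<Prod>i\<in>F. var i) | F. F \<notin> \<Delta>}"

definition sr_symbolic_power :: "'v set set \<Rightarrow> nat \<Rightarrow> ('v, 'k::field) mpoly set" where
  "sr_symbolic_power \<Delta> m = (\<Inter>F\<in>facets \<Delta>. ideal_power (prime_compl F) m)"

definition cleaner_monomial :: "('v, 'k::field) mpoly set \<Rightarrow> ('v \<Rightarrow>\<^sub>0 nat) \<Rightarrow> bool" where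
  "cleaner_monomial I a \<longleftrightarrow> monom a \<noteq> (1 :: ('v, 'k) mpoly) \<and> monom a \<notin> I \<and>
     min_primes (ideal_sum I (principal_ideal (monom a))) \<subseteq> min_primes I"

inductive k_clean :: "nat \<Rightarrow> ('v, 'k::field) mpoly set \<Rightarrow> bool" for k where
  prime: "monomial_ideal I \<Longrightarrow> I \<noteq> UNIV \<Longrightarrow> prime_ideal I \<Longrightarrow> k_clean k I"
| step: "monomial_ideal I \<Longrightarrow> I \<noteq> UNIV \<Longrightarrow> no_embedded_primes I \<Longrightarrow>
         cleaner_monomial I a \<Longrightarrow> card (supp a) \<le> k + 1 \<Longrightarrow>
         k_clean k (colon_ideal I (monom a)) \<Longrightarrow>
         k_clean k (ideal_sum I (principal_ideal (monom a))) \<Longrightarrow> k_clean k I"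

end

theory Submission
  imports Defs
begin

text \<open>A monomial \<open>x\<^sup>a\<close> lies in the \<open>m\<close>-th symbolic power iff every basis \<open>B\<close> of the dual matroid has
  weight at least \<open>m\<close> with respect to \<open>a\<close>. Shift the weights by a fixed vector \<open>w\<close> and add a set \<open>D\<close> of
  variables, so that only the bases containing \<open>D\<close> matter. Such an ideal is an intersection of
  primary ideals whose radicals are the incomparable primes \<open>P\<^sub>B\<close>, hence it has no embedded primes.
  Let \<open>i\<close> have minimal \<open>w\<close>-weight among the non-loops outside \<open>D\<close>. The colon by \<open>x\<^sub>i\<close> increases \<open>w\<^sub>i\<close>.
  Adding \<open>x\<^sub>i\<close> enlarges \<open>D\<close>, because by basis exchange and the minimality of \<open>w\<^sub>i\<close> the conditions for
  bases avoiding \<open>i\<close> follow from those for bases containing \<open>i\<close>. Thus \<open>x\<^sub>i\<close> is a cleaner, and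
  induction applies to both ideals.\<close>

section \<open>Ideals spanned by monomials\<close>

text \<open>Exponent sets of monomial ideals are the ideals of the additive exponent monoid.\<close>

definition up_closed :: "'a::monoid_add set \<Rightarrow> bool" where
  "up_closed A \<longleftrightarrow> (\<forall>a\<in>A. \<forall>b. a + b \<in> A)"

text \<open>Membership is tested term by term, so operations on ideals become set operations on
  exponents. For up-closed \<open>A\<close> this is the ideal generated by the monomials with
  exponent in \<open>A\<close>.\<close>

definition monom_span :: "('v \<Rightarrow>\<^sub>0 nat) set \<Rightarrow> ('v, 'k::field) mpoly set" where
  "monom_span A = {f. Poly_Mapping.keys f \<subseteq> A}"

lemma up_closedD: "up_closed A \<Longrightarrow> a \<in> A \<Longrightarrow> a + b \<in> A"
  by (simp add: up_closed_def)

lemma up_closedD': "up_closed A \<Longrightarrow> a \<in> A \<Longrightarrow> b + a \<in> A" for a b :: "'a::comm_monoid_add"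
  by (metis add.commute up_closedD)

lemma keys_monom [simp]: "Poly_Mapping.keys (monom a :: ('v, 'k::field) mpoly) = {a}"
  by (simp add: monom_def)

lemma monom_add: "monom (a + b) = (monom a * monom b :: ('v, 'k::field) mpoly)"
  by (simp add: monom_def mult_single)

lemma monom_zero [simp]: "monom 0 = (1 :: ('v, 'k::field) mpoly)"
  by (simp add: monom_def)

lemma monom_mem_span [simp]: "monom a \<in> (monom_span A :: ('v, 'k::field) mpoly set) \<longleftrightarrow> a \<in> A"
  by (simp add: monom_span_def)

lemma monom_span_mono: "A \<subseteq> B \<Longrightarrow> monom_span A \<subseteq> monom_span B"
  by (auto simp: monom_span_def)

lemma monom_span_eq_UNIV_iff:
  "monom_span A = (UNIV :: ('v, 'k::field) mpoly set) \<longleftrightarrow> A = UNIV"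
proof
  assume A: "monom_span A = (UNIV :: ('v, 'k) mpoly set)"
  have "a \<in> A" for a using monom_mem_span[of a A, where 'k = 'k] A by simp
  then show "A = UNIV" by blast
qed (simp add: monom_span_def)

lemma is_idealD:
  assumes "is_ideal I"
  shows "0 \<in> I" "a \<in> I \<Longrightarrow> b \<in> I \<Longrightarrow> a + b \<in> I" "a \<in> I \<Longrightarrow> r * a \<in> I" "a \<in> I \<Longrightarrow> a * r \<in> I"
  using assms by (auto simp: is_ideal_def mult.commute)

lemma is_ideal_monom_span:
  assumes "up_closed A"
  shows "is_ideal (monom_span A :: ('v, 'k::field) mpoly set)"
  unfolding is_ideal_def
proof (intro conjI ballI allI)
  show "0 \<in> (monom_span A :: ('v, 'k) mpoly set)" by (simp add: monom_span_def)
next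
  fix f g :: "('v, 'k) mpoly" assume "f \<in> monom_span A" "g \<in> monom_span A"
  then show "f + g \<in> monom_span A"
    using Poly_Mapping.keys_add[of f g] by (auto simp: monom_span_def)
next
  fix f g :: "('v, 'k) mpoly" assume "f \<in> monom_span A"
  then show "g * f \<in> monom_span A"
    using keys_mult[of g f] up_closedD'[OF assms] by (fastforce simp: monom_span_def)
qed

lemma sum_in_ideal: "is_ideal J \<Longrightarrow> (\<And>x. x \<in> X \<Longrightarrow> h x \<in> J) \<Longrightarrow> sum h X \<in> J"
  by (induction X rule: infinite_finite_induct) (auto simp: is_idealD)

lemma sum_of_terms: "(\<Sum>a\<in>Poly_Mapping.keys f. Poly_Mapping.single a (Poly_Mapping.lookup f a)) = f"
  by (rule poly_mapping_eqI) (simp add: lookup_sum lookup_single when_def in_keys_iff)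

text \<open>A polynomial is the sum of its terms, each a constant times a monomial.\<close>

lemma monom_span_subset_ideal:
  fixes J :: "('v, 'k::field) mpoly set"
  assumes "is_ideal J" "\<And>a. a \<in> A \<Longrightarrow> monom a \<in> J"
  shows "monom_span A \<subseteq> J"
proof
  fix f :: "('v, 'k) mpoly" assume f: "f \<in> monom_span A"
  have "Poly_Mapping.single a (Poly_Mapping.lookup f a) \<in> J" if "a \<in> Poly_Mapping.keys f" for a
  proof -
    have "Poly_Mapping.single a (Poly_Mapping.lookup f a)
        = Poly_Mapping.single 0 (Poly_Mapping.lookup f a) * monom a"
      by (simp add: monom_def mult_single)
    then show ?thesis using that f assms by (auto simp: monom_span_def is_idealD)
  qed
  then show "f \<in> J" by (subst sum_of_terms[symmetric]) (rule sum_in_ideal[OF assms(1)])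
qed

lemma is_ideal_ideal_gen: "is_ideal (ideal_gen A)"
  by (auto simp: ideal_gen_def is_ideal_def)

lemma ideal_gen_superset: "A \<subseteq> ideal_gen A"
  by (auto simp: ideal_gen_def)

lemma ideal_gen_subset: "is_ideal J \<Longrightarrow> A \<subseteq> J \<Longrightarrow> ideal_gen A \<subseteq> J"
  by (auto simp: ideal_gen_def)

lemma monomial_ideal_monom_span:
  assumes "up_closed A"
  shows "monomial_ideal (monom_span A :: ('v, 'k::field) mpoly set)"
proof -
  have "ideal_gen (monom ` A) = (monom_span A :: ('v, 'k) mpoly set)"
    using ideal_gen_superset[of "monom ` A"]
    by (intro equalityI ideal_gen_subset monom_span_subset_ideal
        is_ideal_ideal_gen is_ideal_monom_span assms) auto
  then show ?thesis unfolding monomial_ideal_def by metis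
qed

text \<open>Only one pair of keys can contribute to this coefficient, so the convolution has at most
  one nonzero term.\<close>

lemma lookup_mult_unique_sum:
  fixes f g :: "('v, 'k::field) mpoly"
  assumes "\<And>a' b'. a' \<in> Poly_Mapping.keys f \<Longrightarrow> b' \<in> Poly_Mapping.keys g \<Longrightarrow> a' + b' = a + b
      \<Longrightarrow> a' = a \<and> b' = b"
  shows "Poly_Mapping.lookup (f * g) (a + b) = Poly_Mapping.lookup f a * Poly_Mapping.lookup g b"
proof -
  let ?f = "Poly_Mapping.lookup f" and ?g = "Poly_Mapping.lookup g"
  have "?f l * (\<Sum>q. ?g q when a + b = l + q) = (?f a * ?g b when l = a)" for l
  proof (cases "l = a")
    case True
    then have "(\<Sum>q. ?g q when a + b = l + q) = (\<Sum>q. ?g q when q = b)"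
      by (intro Sum_any.cong) (auto simp: when_def)
    then show ?thesis using True by simp
  next
    case False
    have "(\<Sum>q. ?g q when a + b = l + q) = (\<Sum>q::'v \<Rightarrow>\<^sub>0 nat. 0)" if "?f l \<noteq> 0"
    proof (rule Sum_any.cong)
      fix q
      show "(?g q when a + b = l + q) = 0"
        using that assms[of l q] False by (cases "?g q = 0") (auto simp: when_def in_keys_iff)
    qed
    then show ?thesis using False by (cases "?f l = 0") auto
  qed
  then show ?thesis by (simp add: lookup_mult)
qed

text \<open>Translation by \<open>b\<close> is injective, so no terms cancel.\<close>

lemma keys_mult_monom:
  fixes f :: "('v, 'k::field) mpoly"
  shows "Poly_Mapping.keys (f * monom b) = (\<lambda>a. a + b) ` Poly_Mapping.keys f"
proof
  show "Poly_Mapping.keys (f * monom b) \<subseteq> (\<lambda>a. a + b) ` Poly_Mapping.keys f"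
    using keys_mult[of f "monom b"] by auto
  have "Poly_Mapping.lookup (f * monom b) (a + b) = Poly_Mapping.lookup f a" for a
    by (subst lookup_mult_unique_sum) (auto simp: monom_def lookup_single)
  then show "(\<lambda>a. a + b) ` Poly_Mapping.keys f \<subseteq> Poly_Mapping.keys (f * monom b)"
    by (auto simp: in_keys_iff)
qed

section \<open>Colon by a monomial and sum with a principal monomial ideal\<close>

lemma colon_monom_span:
  "colon_ideal (monom_span A) (monom b) = (monom_span {a. a + b \<in> A} :: ('v, 'k::field) mpoly set)"
  by (auto simp: colon_ideal_def monom_span_def keys_mult_monom)

lemma is_ideal_sum_principal: "is_ideal I \<Longrightarrow> is_ideal (ideal_sum I (principal_ideal u))"
  unfolding is_ideal_def[of "ideal_sum I (principal_ideal u)"]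
proof (intro conjI ballI allI)
  assume I: "is_ideal I"
  show "0 \<in> ideal_sum I (principal_ideal u)"
    using is_idealD(1)[OF I] by (force simp: ideal_sum_def principal_ideal_def intro: exI[of _ 0])
  fix a assume "a \<in> ideal_sum I (principal_ideal u)"
  then obtain x g where a: "a = x + g * u" "x \<in> I" by (auto simp: ideal_sum_def principal_ideal_def)
  have "r * a = r * x + (r * g) * u" for r using a by (simp add: algebra_simps)
  then show "r * a \<in> ideal_sum I (principal_ideal u)" for r
    unfolding ideal_sum_def principal_ideal_def using a(2) is_idealD(3)[OF I] by blast
  fix b assume "b \<in> ideal_sum I (principal_ideal u)"
  then obtain y h where b: "b = y + h * u" "y \<in> I" by (auto simp: ideal_sum_def principal_ideal_def)
  have "a + b = (x + y) + (g + h) * u" using a b by (simp add: algebra_simps)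
  then show "a + b \<in> ideal_sum I (principal_ideal u)"
    unfolding ideal_sum_def principal_ideal_def using a b is_idealD(2)[OF I] by blast
qed

lemma ideal_sum_monom_span:
  fixes A :: "('v \<Rightarrow>\<^sub>0 nat) set"
  assumes "up_closed A"
  shows "ideal_sum (monom_span A) (principal_ideal (monom b))
    = (monom_span (A \<union> range (\<lambda>c. c + b)) :: ('v, 'k::field) mpoly set)" (is "?L = ?R")
proof
  have "up_closed (A \<union> range (\<lambda>c. c + b))"
    using assms unfolding up_closed_def
    by (auto, metis (no_types, lifting) add.assoc add.commute rangeI)
  then have R: "is_ideal ?R" by (rule is_ideal_monom_span)
  show "?L \<subseteq> ?R"
  proof
    fix f assume "f \<in> ?L"
    then obtain x g where f: "f = x + g * monom b" "x \<in> monom_span A"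
      by (auto simp: ideal_sum_def principal_ideal_def)
    then have "x \<in> ?R" "g * monom b \<in> ?R" by (auto simp: monom_span_def keys_mult_monom)
    then show "f \<in> ?R" using f is_idealD[OF R] by simp
  qed
  have A: "is_ideal (monom_span A :: ('v, 'k) mpoly set)" by (rule is_ideal_monom_span[OF assms])
  show "?R \<subseteq> ?L"
  proof (rule monom_span_subset_ideal)
    show "is_ideal ?L" by (rule is_ideal_sum_principal[OF A])
    fix a assume "a \<in> A \<union> range (\<lambda>c. c + b)"
    then show "monom a \<in> ?L"
    proof
      assume "a \<in> A"
      then show ?thesis unfolding ideal_sum_def principal_ideal_def
        by (intro CollectI exI[of _ "monom a"] exI[of _ 0]) (auto intro: exI[of _ 0])
    next
      assume "a \<in> range (\<lambda>c. c + b)"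
      then show ?thesis unfolding ideal_sum_def principal_ideal_def
        using is_idealD(1)[OF A] by (force simp: monom_add)
    qed
  qed
qed

section \<open>Prime and primary monomial ideals\<close>

text \<open>For finite \<open>'v\<close>, the largest \<open>n\<close> such that the monomial lies
  in the \<open>n\<close>-th power of the prime generated by the variables in
  \<open>B\<close>.\<close>

definition wt :: "'v set \<Rightarrow> ('v \<Rightarrow>\<^sub>0 nat) \<Rightarrow> nat" where
  "wt B a = (\<Sum>j\<in>B. Poly_Mapping.lookup a j)"

definition var_ideal :: "'v set \<Rightarrow> ('v, 'k::field) mpoly set" where
  "var_ideal B = monom_span {a. wt B a > 0}"

lemma wt_add: "wt B (a + b) = wt B a + wt B b"
  by (simp add: wt_def lookup_add sum.distrib)

lemma wt_zero [simp]: "wt B 0 = 0"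
  by (simp add: wt_def)

lemma wt_single [simp]: "wt B (Poly_Mapping.single i n) = (if i \<in> B then n else 0)"
  for B :: "'v::finite set"
  by (simp add: wt_def lookup_single when_def)

lemma wt_mono: "B \<subseteq> C \<Longrightarrow> wt B a \<le> wt C a" for B :: "'v::finite set"
  by (simp add: wt_def sum_mono2)

lemma wt_pos_iff: "0 < wt B a \<longleftrightarrow> (\<exists>j\<in>B. 0 < Poly_Mapping.lookup a j)" for B :: "'v::finite set"
proof -
  have "wt B a = 0 \<longleftrightarrow> (\<forall>j\<in>B. Poly_Mapping.lookup a j = 0)" by (simp add: wt_def)
  then show ?thesis by auto
qed

lemma split_off_var:
  assumes "0 < Poly_Mapping.lookup a j"
  obtains c where "a = c + Poly_Mapping.single j (1::nat)"
proof
  show "a = (a - Poly_Mapping.single j 1) + Poly_Mapping.single j 1"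
    using assms by (intro poly_mapping_eqI) (auto simp: lookup_add lookup_minus lookup_single when_def)
qed

lemma up_closed_wt_pos: "up_closed {a. wt B a > 0}"
  by (auto simp: up_closed_def wt_add)

text \<open>The unique product property of the exponent monoid: minimise one coordinate after the other.\<close>

lemma unique_sum:
  fixes X Y :: "('v::finite \<Rightarrow>\<^sub>0 nat) set"
  assumes "X \<noteq> {}" "Y \<noteq> {}"
  obtains a b where "a \<in> X" "b \<in> Y"
    "\<And>a' b'. a' \<in> X \<Longrightarrow> b' \<in> Y \<Longrightarrow> a' + b' = a + b \<Longrightarrow> a' = a \<and> b' = b"
proof -
  \<comment> \<open>Induction on the set \<open>V\<close> of coordinates already treated. Only the
    first summand is tracked; the second is recovered by cancellation.\<close>
  have "\<exists>a\<in>X. \<exists>b\<in>Y. \<forall>a'\<in>X. \<forall>b'\<in>Y. a' + b' = a + b \<longrightarrow>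
      (\<forall>v\<in>V. Poly_Mapping.lookup a' v = Poly_Mapping.lookup a v)" if "finite V" for V
    using that assms
  proof (induction V arbitrary: X Y)
    case empty
    then show ?case by auto
  next
    case (insert v V)
    let ?l = "\<lambda>a. Poly_Mapping.lookup a v"
    define p q where "p = (LEAST n. n \<in> ?l ` X)" and "q = (LEAST n. n \<in> ?l ` Y)"
    define X' Y' where "X' = {a \<in> X. ?l a = p}" and "Y' = {b \<in> Y. ?l b = q}"
    have "p \<in> ?l ` X" "q \<in> ?l ` Y"
      unfolding p_def q_def by (rule LeastI_ex, use insert.prems in blast)+
    then have "X' \<noteq> {}" "Y' \<noteq> {}" by (auto simp: X'_def Y'_def)
    then obtain a b where ab: "a \<in> X'" "b \<in> Y'"
      and u: "\<And>a' b'. a' \<in> X' \<Longrightarrow> b' \<in> Y' \<Longrightarrow> a' + b' = a + b \<Longrightarrow>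
        (\<forall>v\<in>V. Poly_Mapping.lookup a' v = Poly_Mapping.lookup a v)"
      using insert.IH[of X' Y'] by blast
    have "\<forall>v\<in>insert v V. Poly_Mapping.lookup a' v = Poly_Mapping.lookup a v"
      if "a' \<in> X" "b' \<in> Y" "a' + b' = a + b" for a' b'
    proof -
      \<comment> \<open>Two lower bounds whose sum is attained are both attained, which keeps
        \<open>a'\<close> in \<open>X'\<close> and \<open>b'\<close> in \<open>Y'\<close>.\<close>
      have "p \<le> ?l a'" "q \<le> ?l b'" using that by (auto simp: p_def q_def intro: Least_le)
      moreover have "?l a' + ?l b' = p + q"
        using that(3) ab by (metis (mono_tags) X'_def Y'_def lookup_add mem_Collect_eq)
      ultimately have "?l a' = p" "?l b' = q" by auto
      then show ?thesis using u[of a' b'] that ab by (auto simp: X'_def Y'_def)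
    qed
    moreover have "a \<in> X" "b \<in> Y" using ab by (simp_all add: X'_def Y'_def)
    ultimately show ?case by blast
  qed
  from this[of UNIV] obtain a b where "a \<in> X" "b \<in> Y"
    and "\<And>a' b'. a' \<in> X \<Longrightarrow> b' \<in> Y \<Longrightarrow> a' + b' = a + b \<Longrightarrow>
      (\<forall>v. Poly_Mapping.lookup a' v = Poly_Mapping.lookup a v)"
    by (metis UNIV_I finite_UNIV)
  then have u: "\<And>a' b'. a' \<in> X \<Longrightarrow> b' \<in> Y \<Longrightarrow> a' + b' = a + b \<Longrightarrow> a' = a"
    by (auto intro: poly_mapping_eqI)
  have "b' = b" if "a' \<in> X" "b' \<in> Y" "a' + b' = a + b" for a' b'
    using u that by (metis add_left_cancel)
  then show ?thesis using that[OF \<open>a \<in> X\<close> \<open>b \<in> Y\<close>] u by blast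
qed

text \<open>The product of the parts of \<open>f\<close> and \<open>g\<close> of lowest \<open>B\<close>-degree outside the respective
  ideals has a term that nothing can cancel.\<close>

lemma monom_span_primary:
  fixes f g :: "('v::finite, 'k::field) mpoly"
  assumes A: "up_closed A" and free: "\<And>a c. wt B c = 0 \<Longrightarrow> a + c \<in> A \<Longrightarrow> a \<in> A"
    and f: "f \<notin> monom_span A" and g: "g \<notin> var_ideal B"
  shows "f * g \<notin> monom_span A"
proof -
  define F where "F = Poly_Mapping.keys f - A"
  define d where "d = (LEAST n. n \<in> wt B ` F)"
  define X where "X = {a \<in> F. wt B a = d}"
  define Y where "Y = {b \<in> Poly_Mapping.keys g. wt B b = 0}"
  have "F \<noteq> {}" using f by (auto simp: F_def monom_span_def)
  then have "\<exists>n. n \<in> wt B ` F" by blast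
  then have "d \<in> wt B ` F" unfolding d_def by (rule LeastI_ex)
  then have "X \<noteq> {}" by (auto simp: X_def)
  moreover have "Y \<noteq> {}" using g by (auto simp: Y_def var_ideal_def monom_span_def)
  ultimately obtain a b where ab: "a \<in> X" "b \<in> Y"
    and u: "\<And>a' b'. a' \<in> X \<Longrightarrow> b' \<in> Y \<Longrightarrow> a' + b' = a + b \<Longrightarrow> a' = a \<and> b' = b"
    using unique_sum[of X Y] by metis
  \<comment> \<open>\<open>b\<close> has \<open>B\<close>-weight zero, so \<open>free\<close> would
    carry \<open>a + b\<close> in \<open>A\<close> back to \<open>a\<close> in
    \<open>A\<close>.\<close>
  have abA: "a + b \<notin> A" using free[of b a] ab by (auto simp: X_def Y_def F_def)
  have "a' = a \<and> b' = b"
    if "a' \<in> Poly_Mapping.keys f" "b' \<in> Poly_Mapping.keys g" "a' + b' = a + b" for a' b'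
  proof (rule u)
    \<comment> \<open>If \<open>a'\<close> were in \<open>A\<close>, so would be
      \<open>a + b\<close>. Minimality of \<open>d\<close> then forces the weights \<open>d\<close>
      and \<open>0\<close>.\<close>
    have "a' \<in> F" using that abA up_closedD[OF A, of a' b'] by (auto simp: F_def)
    then have "d \<le> wt B a'" by (auto simp: d_def intro: Least_le)
    moreover have "wt B a' + wt B b' = d"
      using that(3) ab by (metis (mono_tags, lifting) X_def Y_def add.right_neutral mem_Collect_eq wt_add)
    ultimately show "a' \<in> X" "b' \<in> Y" using that \<open>a' \<in> F\<close> by (auto simp: X_def Y_def)
  qed (fact that(3))
  then have "Poly_Mapping.lookup (f * g) (a + b) \<noteq> 0"
    using ab by (subst lookup_mult_unique_sum) (auto simp: X_def Y_def F_def in_keys_iff)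
  then show ?thesis using abA by (auto simp: monom_span_def in_keys_iff)
qed

text \<open>The exponent set of \<open>var_ideal B\<close> meets the hypotheses of
  \<open>monom_span_primary\<close> for the same \<open>B\<close>, where the conclusion becomes
  primeness.\<close>

lemma prime_var_ideal: "prime_ideal (var_ideal B :: ('v::finite, 'k::field) mpoly set)"
proof -
  have "f * g \<notin> var_ideal B" if "f \<notin> var_ideal B" "g \<notin> var_ideal B" for f g :: "('v, 'k) mpoly"
    unfolding var_ideal_def using that
    by (intro monom_span_primary[OF up_closed_wt_pos, of B]) (auto simp: wt_add var_ideal_def)
  moreover have "0 \<notin> {a. 0 < wt B a}" by simp
  then have "{a. 0 < wt B a} \<noteq> UNIV" by blast
  ultimately show ?thesis
    using is_ideal_monom_span[OF up_closed_wt_pos]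
    by (auto simp: prime_ideal_def var_ideal_def monom_span_eq_UNIV_iff)
qed

lemma var_ideal_subset_iff:
  "var_ideal B \<subseteq> (var_ideal C :: ('v::finite, 'k::field) mpoly set) \<longleftrightarrow> B \<subseteq> C"
proof
  show "B \<subseteq> C" if "var_ideal B \<subseteq> (var_ideal C :: ('v, 'k) mpoly set)"
  proof
    fix j assume "j \<in> B"
    then have "monom (Poly_Mapping.single j 1) \<in> (var_ideal B :: ('v, 'k) mpoly set)"
      by (simp add: var_ideal_def)
    then have "monom (Poly_Mapping.single j 1) \<in> (var_ideal C :: ('v, 'k) mpoly set)" using that by blast
    then show "j \<in> C" by (simp add: var_ideal_def split: if_splits)
  qed
  show "var_ideal B \<subseteq> (var_ideal C :: ('v, 'k) mpoly set)" if "B \<subseteq> C"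
    unfolding var_ideal_def using wt_mono[OF that] by (intro monom_span_mono) (auto intro: less_le_trans)
qed

lemma var_ideal_subset_prime:
  fixes P :: "('v::finite, 'k::field) mpoly set"
  assumes "is_ideal P" "\<And>j. j \<in> B \<Longrightarrow> var j \<in> P"
  shows "var_ideal B \<subseteq> P"
  unfolding var_ideal_def
proof (rule monom_span_subset_ideal[OF assms(1)])
  fix a assume "a \<in> {a. 0 < wt B a}"
  then obtain j where j: "j \<in> B" "0 < Poly_Mapping.lookup a j" by (auto simp: wt_pos_iff)
  obtain c where "a = c + Poly_Mapping.single j 1" by (rule split_off_var[OF j(2)])
  then show "monom a \<in> P" using assms j by (auto simp: monom_add var_def is_idealD)
qed

text \<open>Peel off one variable at a time, by induction on the total degree
  \<open>wt UNIV a\<close>.\<close>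

lemma monom_notin_prime:
  fixes P :: "('v::finite, 'k::field) mpoly set"
  assumes P: "prime_ideal P" and "\<And>j. 0 < Poly_Mapping.lookup a j \<Longrightarrow> var j \<notin> P"
  shows "monom a \<notin> P"
  using assms(2)
proof (induction "wt UNIV a" arbitrary: a)
  case 0
  then have "a = 0"
    by (intro poly_mapping_eqI) (use wt_pos_iff[of UNIV a] in auto)
  have "1 \<notin> P"
    using P is_idealD(3)[of P 1] by (auto simp: prime_ideal_def)
  then show ?case using \<open>a = 0\<close> by simp
next
  case (Suc n)
  then obtain j where j: "0 < Poly_Mapping.lookup a j" by (metis wt_pos_iff zero_less_Suc)
  obtain c where c: "a = c + Poly_Mapping.single j 1" by (rule split_off_var[OF j])
  have "n = wt UNIV c" using Suc.hyps(2) c by (simp add: wt_add)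
  moreover have "var i \<notin> P" if "0 < Poly_Mapping.lookup c i" for i
    using Suc.prems[of i] c that by (simp add: lookup_add)
  ultimately have "monom c \<notin> P" using Suc.hyps(1) by blast
  then show ?case
    using Suc.prems[OF j] P c by (auto simp: monom_add var_def prime_ideal_def)
qed

section \<open>Symbolic powers\<close>

lemma up_closed_wt_ge: "up_closed {a. m \<le> wt B a}"
  by (auto simp: up_closed_def wt_add)

lemma prod_list_monom_span:
  fixes xs :: "('v::finite, 'k::field) mpoly list"
  assumes "set xs \<subseteq> var_ideal B"
  shows "prod_list xs \<in> monom_span {a. length xs \<le> wt B a}"
  using assms
proof (induction xs)
  case Nil
  then show ?case by (simp add: monom_span_def)
next
  case (Cons x xs)
  then have "Poly_Mapping.keys x \<subseteq> {a. 0 < wt B a}"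
    "Poly_Mapping.keys (prod_list xs) \<subseteq> {a. length xs \<le> wt B a}"
    by (auto simp: monom_span_def var_ideal_def)
  then show ?case
    using keys_mult[of x "prod_list xs"] by (fastforce simp: monom_span_def wt_add)
qed

lemma monom_factor_vars:
  assumes "m \<le> wt B a"
  shows "\<exists>xs c. length xs = m \<and> set xs \<subseteq> var ` B \<and>
    monom a = monom c * (prod_list xs :: ('v::finite, 'k::field) mpoly)"
  using assms
proof (induction m arbitrary: a)
  case 0
  then show ?case by (intro exI[of _ "[]"] exI[of _ a]) simp
next
  case (Suc m)
  then obtain j where j: "j \<in> B" "0 < Poly_Mapping.lookup a j"
    by (metis wt_pos_iff less_le_trans zero_less_Suc)
  obtain c where c: "a = c + Poly_Mapping.single j 1" by (rule split_off_var[OF j(2)])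
  then have "m \<le> wt B c" using Suc.prems j by (simp add: wt_add)
  from Suc.IH[OF this] obtain xs d where "length xs = m" "set xs \<subseteq> var ` B"
    "monom c = monom d * (prod_list xs :: ('v, 'k) mpoly)" by blast
  then show ?case using j c
    by (intro exI[of _ "var j # xs"] exI[of _ d]) (simp add: monom_add var_def mult_ac)
qed

text \<open>Turns symbolic powers into weight inequalities: a power of a prime generated by
  variables is determined by the degree in those variables.\<close>

lemma ideal_power_prime_compl:
  "ideal_power (prime_compl F) m
    = (monom_span {a. m \<le> wt (- F) a} :: ('v::finite, 'k::field) mpoly set)" (is "?L = ?R")
proof
  have "prime_compl F \<subseteq> (var_ideal (- F) :: ('v, 'k) mpoly set)"
    unfolding prime_compl_def
    by (intro ideal_gen_subset)
      (use prime_var_ideal in \<open>auto simp: prime_ideal_def var_ideal_def var_def\<close>)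
  then show "?L \<subseteq> ?R"
    unfolding ideal_power_def
    by (intro ideal_gen_subset is_ideal_monom_span up_closed_wt_ge)
      (use prod_list_monom_span[of _ "- F"] in fastforce)
  have sub: "var ` (- F) \<subseteq> (prime_compl F :: ('v, 'k) mpoly set)"
    unfolding prime_compl_def by (rule ideal_gen_superset)
  show "?R \<subseteq> ?L"
  proof (rule monom_span_subset_ideal)
    show L: "is_ideal ?L" unfolding ideal_power_def by (rule is_ideal_ideal_gen)
    fix a assume "a \<in> {a. m \<le> wt (- F) a}"
    then obtain xs :: "('v, 'k) mpoly list" and c where xs: "length xs = m" "set xs \<subseteq> var ` (- F)"
      "monom a = monom c * prod_list xs" using monom_factor_vars[of m "- F" a] by blast
    have "set xs \<subseteq> prime_compl F" using xs(2) sub by (rule subset_trans)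
    then have "prod_list xs \<in> ?L"
      unfolding ideal_power_def using xs(1) by (intro subsetD[OF ideal_gen_superset] CollectI) blast
    then show "monom a \<in> ?L" unfolding xs(3) by (rule is_idealD(3)[OF L])
  qed
qed

section \<open>Weighted basis families\<close>

text \<open>\<open>Bs\<close> is the family of bases of the dual matroid. The ideal \<open>state_ideal D w\<close> arises from the
  symbolic power by adding the variables in \<open>D\<close> and taking the colon by the monomial with
  exponent \<open>w\<close>.\<close>

locale weighted_bases =
  fixes Bs :: "'v::finite set set" and m :: nat
  assumes exchange: "B \<in> Bs \<Longrightarrow> C \<in> Bs \<Longrightarrow> i \<in> C - B \<Longrightarrow> \<exists>j\<in>B - C. insert i (B - {j}) \<in> Bs"
begin

definition state :: "'v set \<Rightarrow> ('v \<Rightarrow>\<^sub>0 nat) \<Rightarrow> ('v \<Rightarrow>\<^sub>0 nat) set" where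
  "state D w = {a. 0 < wt D a \<or> (\<forall>B\<in>Bs. D \<subseteq> B \<longrightarrow> m \<le> wt B (a + w))}"

text \<open>If \<open>m \<le> wt B w\<close>, the inequality of \<open>B\<close> holds for every
  \<open>a\<close>. The remaining bases index the minimal primes.\<close>

definition active :: "'v set \<Rightarrow> ('v \<Rightarrow>\<^sub>0 nat) \<Rightarrow> 'v set set" where
  "active D w = {B \<in> Bs. D \<subseteq> B \<and> wt B w < m}"

text \<open>For \<open>D\<close> inside some basis, the non-loops of the contraction by
  \<open>D\<close>.\<close>

definition nonloops :: "'v set \<Rightarrow> 'v set" where
  "nonloops D = \<Union>{B \<in> Bs. D \<subseteq> B} - D"

abbreviation state_ideal :: "'v set \<Rightarrow> ('v \<Rightarrow>\<^sub>0 nat) \<Rightarrow> ('v, 'k::field) mpoly set" where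
  "state_ideal D w \<equiv> monom_span (state D w)"

text \<open>For \<open>B \<subset> C\<close> the exchange would need an element of the empty set
  \<open>B - C\<close>.\<close>

lemma antichain: "B \<in> Bs \<Longrightarrow> C \<in> Bs \<Longrightarrow> B \<subseteq> C \<Longrightarrow> B = C"
  using exchange[of B C] by blast

lemma up_closed_state: "up_closed (state D w)"
  unfolding up_closed_def state_def by (fastforce simp: wt_add)

lemma zero_notin_state: "active D w \<noteq> {} \<Longrightarrow> 0 \<notin> state D w"
  by (auto simp: state_def active_def not_le)

lemma state_ideal_proper:
  "active D w \<noteq> {} \<Longrightarrow> (state_ideal D w :: ('v, 'k::field) mpoly set) \<noteq> UNIV"
  using zero_notin_state by (auto simp: monom_span_eq_UNIV_iff)

section \<open>Minimal and associated primes of the state ideals\<close>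

lemma state_ideal_subset_var_ideal:
  assumes "B \<in> active D w"
  shows "state_ideal D w \<subseteq> (var_ideal B :: ('v, 'k::field) mpoly set)"
  unfolding var_ideal_def
proof (rule monom_span_mono, rule subsetI)
  fix a assume "a \<in> state D w"
  then show "a \<in> {a. 0 < wt B a}"
    using assms wt_mono[of D B a] by (auto simp: state_def active_def wt_add)
qed

text \<open>Otherwise the \<open>m\<close>-th power of the product of all variables outside
  \<open>P\<close> would lie in the ideal: every active basis contains such a variable. But a prime
  cannot contain this monomial.\<close>

lemma active_below_prime:
  fixes P :: "('v, 'k::field) mpoly set"
  assumes P: "prime_ideal P" "state_ideal D w \<subseteq> P"
  shows "\<exists>B\<in>active D w. var_ideal B \<subseteq> P"
proof (rule ccontr)
  assume none: "\<not> ?thesis"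
  define T where "T = {j. var j \<in> P}"
  have PI: "is_ideal P" using P by (simp add: prime_ideal_def)
  have noT: "\<not> B \<subseteq> T" if "B \<in> active D w" for B
    using none that var_ideal_subset_prime[OF PI, of B] by (auto simp: T_def)
  define a where "a = Abs_poly_mapping (\<lambda>j. if j \<in> T then 0 else m)"
  have a: "Poly_Mapping.lookup a j = (if j \<in> T then 0 else m)" for j
    unfolding a_def by (subst lookup_Abs_poly_mapping) auto
  have "m \<le> wt B (a + w)" if "B \<in> Bs" "D \<subseteq> B" for B
  proof (cases "m \<le> wt B w")
    case True
    then show ?thesis by (simp add: wt_add)
  next
    case False
    then have "\<not> B \<subseteq> T" using that by (intro noT) (simp add: active_def)
    then obtain j where j: "j \<in> B" "j \<notin> T" by blast
    then have "m \<le> wt B a" using a wt_mono[of "{j}" B a] by (simp add: wt_def)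
    then show ?thesis by (simp add: wt_add)
  qed
  then have "monom a \<in> P" using P(2) monom_mem_span[of a "state D w"] by (auto simp: state_def)
  moreover have "monom a \<notin> P"
    by (rule monom_notin_prime[OF P(1)]) (auto simp: a T_def split: if_splits)
  ultimately show False by simp
qed

text \<open>Every prime above the ideal lies above some active \<open>var_ideal B\<close>, and
  \<open>antichain\<close> makes these pairwise incomparable.\<close>

lemma min_primes_state_ideal:
  "min_primes (state_ideal D w) = (var_ideal ` active D w :: ('v, 'k::field) mpoly set set)"
proof (intro equalityI subsetI)
  fix P :: "('v, 'k) mpoly set" assume P: "P \<in> min_primes (state_ideal D w)"
  then have "prime_ideal P" "state_ideal D w \<subseteq> P" by (auto simp: min_primes_def)
  then obtain B where B: "B \<in> active D w" "var_ideal B \<subseteq> P" using active_below_prime by blast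
  then have "var_ideal B = P"
    using P prime_var_ideal state_ideal_subset_var_ideal[OF B(1)] unfolding min_primes_def by blast
  then show "P \<in> var_ideal ` active D w" using B by blast
next
  fix P :: "('v, 'k) mpoly set" assume "P \<in> var_ideal ` active D w"
  then obtain B where B: "B \<in> active D w" "P = var_ideal B" by blast
  have "Q = P" if Q: "prime_ideal Q" "state_ideal D w \<subseteq> Q" "Q \<subseteq> P" for Q
  proof -
    obtain C where C: "C \<in> active D w" "var_ideal C \<subseteq> Q" using active_below_prime Q by blast
    then have "C \<subseteq> B" using Q(3) B(2) var_ideal_subset_iff by blast
    then have "C = B" using antichain B(1) C(1) by (auto simp: active_def)
    then show ?thesis using C Q B by blast
  qed
  then show "P \<in> min_primes (state_ideal D w)"
    using B prime_var_ideal state_ideal_subset_var_ideal[OF B(1)] unfolding min_primes_def by blast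
qed

text \<open>If \<open>f\<close> lies outside the component of \<open>B\<close>, primariness of that component
  gives \<open>(I : f) \<subseteq> P\<^sub>B\<close>.\<close>

lemma no_embedded_primes_state_ideal:
  "no_embedded_primes (state_ideal D w :: ('v, 'k::field) mpoly set)"
  unfolding no_embedded_primes_def
proof
  fix P :: "('v, 'k) mpoly set" assume "P \<in> ass_primes (state_ideal D w)"
  then obtain f where P: "prime_ideal P" and f: "P = colon_ideal (state_ideal D w) f"
    by (auto simp: ass_primes_def)
  have "state_ideal D w \<subseteq> P"
    unfolding f colon_ideal_def using is_idealD(4)[OF is_ideal_monom_span[OF up_closed_state]] by blast
  then obtain C where C: "C \<in> active D w" "var_ideal C \<subseteq> P" using active_below_prime P by blast
  have "f \<notin> state_ideal D w"
    using P is_idealD(3)[OF is_ideal_monom_span[OF up_closed_state], of f]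
    unfolding prime_ideal_def f colon_ideal_def by auto
  then obtain a where a: "a \<in> Poly_Mapping.keys f" "a \<notin> state D w" by (auto simp: monom_span_def)
  then obtain B where B: "B \<in> Bs" "D \<subseteq> B" "wt B (a + w) < m" "wt D a = 0"
    by (auto simp: state_def not_le)
  \<comment> \<open>The exponents of the component of \<open>B\<close>. As
    \<open>D \<subseteq> B\<close>, zero \<open>B\<close>-weight implies zero
    \<open>D\<close>-weight, so \<open>monom_span_primary\<close> applies.\<close>
  define Q where "Q = {a. 0 < wt D a \<or> m \<le> wt B (a + w)}"
  have "state_ideal D w \<subseteq> monom_span Q"
    using B by (intro monom_span_mono) (auto simp: state_def Q_def)
  have "f \<notin> monom_span Q" using a B by (auto simp: monom_span_def Q_def)
  have "P \<subseteq> var_ideal B"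
  proof
    fix g assume "g \<in> P"
    then have "f * g \<in> monom_span Q"
      using \<open>state_ideal D w \<subseteq> monom_span Q\<close> by (auto simp: f colon_ideal_def mult.commute)
    moreover have "up_closed Q" by (auto simp: up_closed_def Q_def wt_add)
    moreover have "x \<in> Q" if "wt B c = 0" "x + c \<in> Q" for x c
      using that wt_mono[OF B(2), of c] by (auto simp: Q_def wt_add)
    ultimately show "g \<in> var_ideal B" using monom_span_primary \<open>f \<notin> monom_span Q\<close> by metis
  qed
  \<comment> \<open>Now \<open>P\<close> lies between \<open>var_ideal C\<close> and
    \<open>var_ideal B\<close>, and \<open>antichain\<close> closes the gap.\<close>
  then have "C \<subseteq> B" using C var_ideal_subset_iff by blast
  then have "C = B" using antichain B(1) C(1) by (auto simp: active_def)
  then have "P = var_ideal B" using C \<open>P \<subseteq> var_ideal B\<close> by blast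
  then show "P \<in> min_primes (state_ideal D w)"
    unfolding min_primes_state_ideal using C \<open>C = B\<close> by blast
qed

section \<open>Colon by a variable and addition of a variable\<close>

lemma state_colon: "i \<notin> D \<Longrightarrow>
    {a. a + Poly_Mapping.single i 1 \<in> state D w} = state D (w + Poly_Mapping.single i 1)"
  by (auto simp: state_def wt_add ac_simps)

text \<open>The outgoing \<open>j\<close> is outside \<open>C\<close>, hence outside
  \<open>D\<close>, so it is a non-loop. Replacing it by \<open>i\<close> of minimal weight does not
  raise the \<open>w\<close>-weight.\<close>

lemma exchange_into:
  assumes "B \<in> Bs" "D \<subseteq> B" "i \<notin> B" "C \<in> Bs" "D \<subseteq> C" "i \<in> C"
    and min: "\<forall>j\<in>nonloops D. Poly_Mapping.lookup w i \<le> Poly_Mapping.lookup w j"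
  obtains j where "j \<in> B - D" "insert i (B - {j}) \<in> Bs" "insert i D \<subseteq> insert i (B - {j})"
    "wt (insert i (B - {j})) w \<le> wt B w"
proof -
  obtain j where j: "j \<in> B - C" "insert i (B - {j}) \<in> Bs" using exchange assms by blast
  have "wt B w = Poly_Mapping.lookup w j + wt (B - {j}) w"
    unfolding wt_def using j by (simp add: sum.remove)
  moreover have "wt (insert i (B - {j})) w = Poly_Mapping.lookup w i + wt (B - {j}) w"
    unfolding wt_def using assms by simp
  moreover have "j \<in> B - D" using j assms by auto
  moreover from this have "Poly_Mapping.lookup w i \<le> Poly_Mapping.lookup w j"
    using min assms by (auto simp: nonloops_def)
  ultimately show ?thesis using j assms by (intro that[of j]) auto
qed

text \<open>The new state drops the inequalities of bases avoiding \<open>i\<close>. For exponents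
  vanishing at \<open>i\<close> they follow through \<open>exchange_into\<close>, with
  \<open>C\<close> as the source of \<open>i\<close>; all other exponents are multiples of the
  variable.\<close>

lemma state_add_var:
  assumes "C \<in> Bs" "insert i D \<subseteq> C" "i \<notin> D"
    and min: "\<forall>j\<in>nonloops D. Poly_Mapping.lookup w i \<le> Poly_Mapping.lookup w j"
  shows "state D w \<union> range (\<lambda>c. c + Poly_Mapping.single i 1) = state (insert i D) w"
proof (intro equalityI subsetI)
  fix a assume "a \<in> state D w \<union> range (\<lambda>c. c + Poly_Mapping.single i 1)"
  moreover have "wt D a \<le> wt (insert i D) a" by (rule wt_mono) blast
  ultimately show "a \<in> state (insert i D) w"
    by (auto simp: state_def wt_add)
next
  fix a assume a: "a \<in> state (insert i D) w"
  show "a \<in> state D w \<union> range (\<lambda>c. c + Poly_Mapping.single i 1)"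
  proof (cases "0 < Poly_Mapping.lookup a i")
    case True
    then obtain c where "a = c + Poly_Mapping.single i 1" by (rule split_off_var)
    then show ?thesis by blast
  next
    case ai: False
    have "m \<le> wt B (a + w)" if B: "B \<in> Bs" "D \<subseteq> B" and "wt D a = 0" for B
    proof -
      have "wt (insert i D) a = 0" using ai \<open>wt D a = 0\<close> assms(3) by (simp add: wt_def)
      then have all: "m \<le> wt B (a + w)" if "B \<in> Bs" "insert i D \<subseteq> B" for B
        using a that unfolding state_def by auto
      show ?thesis
      proof (cases "i \<in> B")
        case True
        then show ?thesis using all B by auto
      next
        case False
        then obtain j where j: "j \<in> B - D" "insert i (B - {j}) \<in> Bs"
          "insert i D \<subseteq> insert i (B - {j})" "wt (insert i (B - {j})) w \<le> wt B w"
          using exchange_into[OF B False assms(1) _ _ min] assms(2) by auto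
        \<comment> \<open>As \<open>a\<close> vanishes at \<open>i\<close>, the exchange can only
          lose the entry at \<open>j\<close>.\<close>
        have "wt (insert i (B - {j})) a \<le> wt B a"
          using ai False wt_mono[of "B - {j}" B a] by (simp add: wt_def)
        then show ?thesis using all[OF j(2,3)] j(4) by (simp add: wt_add)
      qed
    qed
    then show ?thesis by (auto simp: state_def)
  qed
qed

text \<open>The variable to shed is one of minimal weight. If it already lies in the ideal, it can be
  moved to \<open>D\<close> without changing the ideal.\<close>

lemma k_clean_state_ideal:
  assumes "active D w \<noteq> {}"
  shows "k_clean 0 (state_ideal D w :: ('v, 'k::field) mpoly set)"
  using assms
\<comment> \<open>Adding a variable shrinks the complement of \<open>D\<close>. The colon keeps
  \<open>D\<close> and lowers the total deficit of the bases below \<open>m\<close>.\<close>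
proof (induction "(card (- D), \<Sum>B\<in>Bs. m - wt B w)" arbitrary: D w
    rule: wf_induct_rule[OF wf_lex_prod[OF wf_less_than wf_less_than]])
  case (1 D w)
  let ?I = "state_ideal D w :: ('v, 'k) mpoly set"
  let ?e = "\<lambda>i. Poly_Mapping.single i (1::nat)"
  have IH_add: "k_clean 0 (state_ideal (insert i D) w :: ('v, 'k) mpoly set)"
    if "active (insert i D) w \<noteq> {}" "i \<notin> D" for i
  proof (rule 1(1))
    have "card (- insert i D) < card (- D)" using that(2) by (intro psubset_card_mono) auto
    then show "((card (- insert i D), \<Sum>B\<in>Bs. m - wt B w), (card (- D), \<Sum>B\<in>Bs. m - wt B w))
        \<in> less_than <*lex*> less_than" by simp
  qed (fact that(1))
  have mon: "monomial_ideal ?I" by (rule monomial_ideal_monom_span[OF up_closed_state])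
  have proper: "?I \<noteq> UNIV" by (rule state_ideal_proper[OF "1.prems"])
  show ?case
  proof (cases "nonloops D = {}")
    case True
    obtain B where B: "B \<in> active D w" using "1.prems" by blast
    \<comment> \<open>Elements of \<open>B - D\<close> would be non-loops. The inequality of the
      basis \<open>D\<close> then fails for every \<open>a\<close> of \<open>D\<close>-weight zero,
      so only the variables in \<open>D\<close> remain.\<close>
    then have "B = D" using True by (auto simp: nonloops_def active_def)
    then have "state D w = {a. 0 < wt D a}"
      using B by (auto simp: state_def active_def wt_add)
    then have "prime_ideal ?I" using prime_var_ideal[of D] by (simp add: var_ideal_def)
    then show ?thesis using mon proper by (rule k_clean.prime[rotated 2])
  next
    case False
    define i where "i = arg_min_on (Poly_Mapping.lookup w) (nonloops D)"
    have iN: "i \<in> nonloops D" unfolding i_def using False by (intro arg_min_if_finite) auto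
    have "Poly_Mapping.lookup w i \<le> Poly_Mapping.lookup w j" if "j \<in> nonloops D" for j
      unfolding i_def using False that by (intro arg_min_least) auto
    then have min: "\<forall>j\<in>nonloops D. Poly_Mapping.lookup w i \<le> Poly_Mapping.lookup w j" by simp
    obtain C where C: "C \<in> Bs" "insert i D \<subseteq> C" "i \<notin> D" using iN by (auto simp: nonloops_def)
    note add_var = state_add_var[OF C min]
    \<comment> \<open>An active basis avoiding \<open>i\<close> can be exchanged for one through
      \<open>i\<close> of no larger weight, so the sum stays proper.\<close>
    have act: "active (insert i D) w \<noteq> {}"
    proof -
      obtain B where B: "B \<in> Bs" "D \<subseteq> B" "wt B w < m" using "1.prems" by (auto simp: active_def)
      show ?thesis
      proof (cases "i \<in> B")
        case True
        then show ?thesis using B by (auto simp: active_def)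
      next
        case False
        then obtain j where "j \<in> B - D" "insert i (B - {j}) \<in> Bs"
          "insert i D \<subseteq> insert i (B - {j})" "wt (insert i (B - {j})) w \<le> wt B w"
          using exchange_into[OF B(1,2) False C(1) _ _ min] C(2) by auto
        then have "insert i (B - {j}) \<in> active (insert i D) w" using B by (auto simp: active_def)
        then show ?thesis by blast
      qed
    qed
    note clean_add = IH_add[OF act C(3)]
    show ?thesis
    proof (cases "?e i \<in> state D w")
      case True
      then have "range (\<lambda>c. c + ?e i) \<subseteq> state D w"
        using up_closedD'[OF up_closed_state] by blast
      then have "state (insert i D) w = state D w" using add_var by blast
      then show ?thesis using clean_add by simp
    next
      case False
      have sum_eq: "ideal_sum ?I (principal_ideal (monom (?e i))) = state_ideal (insert i D) w"
        by (simp only: ideal_sum_monom_span[OF up_closed_state] add_var)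
      have colon_eq: "colon_ideal ?I (monom (?e i)) = state_ideal D (w + ?e i)"
        by (simp only: colon_monom_span state_colon[OF C(3)])
      have "?e i \<noteq> 0" by (metis lookup_single_eq lookup_zero zero_neq_one)
      then have monom_ne: "monom (?e i) \<noteq> (1 :: ('v, 'k) mpoly)"
        by (metis keys_monom keys_one singleton_inject)
      \<comment> \<open>These two families index the minimal primes of the sum and of the
        ideal.\<close>
      have "active (insert i D) w \<subseteq> active D w" by (auto simp: active_def)
      then have cleaner: "cleaner_monomial ?I (?e i)"
        using False monom_ne unfolding cleaner_monomial_def sum_eq min_primes_state_ideal
        by (simp only: monom_mem_span image_mono simp_thms)
      have clean_colon: "k_clean 0 (colon_ideal ?I (monom (?e i)))"
        unfolding colon_eq
      proof (rule 1(1))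
        \<comment> \<open>A variable outside the ideal violates the inequality of some basis, which
          therefore remains active after the shift.\<close>
        obtain B where "B \<in> Bs" "D \<subseteq> B" "\<not> m \<le> wt B (?e i + w)"
          using False unfolding state_def by blast
        then have "B \<in> active D (w + ?e i)" by (simp add: active_def add.commute)
        then show "active D (w + ?e i) \<noteq> {}" by blast
        \<comment> \<open>Subtraction truncates at \<open>0\<close>, so a strict drop needs a basis
          through \<open>i\<close> of weight below \<open>m\<close>.\<close>
        obtain B where B: "B \<in> Bs" "i \<in> B" "wt B w < m" using act by (auto simp: active_def)
        have "(\<Sum>B\<in>Bs. m - wt B (w + ?e i)) < (\<Sum>B\<in>Bs. m - wt B w)"
        proof (rule sum_strict_mono_ex1)
          show "\<forall>B\<in>Bs. m - wt B (w + ?e i) \<le> m - wt B w" by (intro ballI diff_le_mono2) (simp add: wt_add)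
          have "m - wt B (w + ?e i) < m - wt B w" using B by (simp add: wt_add)
          then show "\<exists>B\<in>Bs. m - wt B (w + ?e i) < m - wt B w" using B(1) by blast
        qed simp
        then show "((card (- D), \<Sum>B\<in>Bs. m - wt B (w + ?e i)), (card (- D), \<Sum>B\<in>Bs. m - wt B w))
          \<in> less_than <*lex*> less_than" by simp
      qed
      have "card (supp (?e i)) \<le> 0 + 1" by (simp add: supp_def)
      then show ?thesis
        by (rule k_clean.step[OF mon proper no_embedded_primes_state_ideal cleaner _
            clean_colon clean_add[folded sum_eq]])
    qed
  qed
qed

end

section \<open>Matroid complexes\<close>

text \<open>A facet smaller than some face could be augmented from it, against maximality.\<close>

lemma matroid_facets_card:
  assumes "matroid_complex \<Delta>" "F \<in> facets \<Delta>" "G \<in> \<Delta>"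
  shows "card G \<le> card F"
proof (rule ccontr)
  assume "\<not> ?thesis"
  then have "card F < card G" by simp
  moreover have "F \<in> \<Delta>" using assms(2) by (simp add: facets_def)
  ultimately obtain x where "x \<in> G - F" "insert x F \<in> \<Delta>"
    using assms(1,3) unfolding matroid_complex_def by blast
  then show False using assms by (auto simp: facets_def)
qed

lemma facet_if_card_ge:
  fixes \<Delta> :: "'v::finite set set"
  assumes "matroid_complex \<Delta>" "F \<in> facets \<Delta>" "G \<in> \<Delta>" "card F \<le> card G"
  shows "G \<in> facets \<Delta>"
proof -
  have "H = G" if "H \<in> \<Delta>" "G \<subseteq> H" for H
    using card_seteq[OF finite that(2)] matroid_facets_card[OF assms(1,2) that(1)] assms(4) by simp
  then show ?thesis using assms(3) by (simp add: facets_def)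
qed

text \<open>Complements reverse the exchange: \<open>i\<close> entering \<open>B\<close> means
  \<open>i\<close> leaving the facet \<open>F\<close>, and augmenting \<open>F - {i}\<close> from
  \<open>G\<close> yields the element leaving \<open>B\<close>.\<close>

lemma weighted_bases_matroid:
  fixes \<Delta> :: "'v::finite set set"
  assumes M: "matroid_complex \<Delta>"
  shows "weighted_bases (uminus ` facets \<Delta>)"
proof
  fix B C :: "'v set" and i
  assume "B \<in> uminus ` facets \<Delta>" "C \<in> uminus ` facets \<Delta>" "i \<in> C - B"
  then obtain F G where F: "F \<in> facets \<Delta>" "B = - F" and G: "G \<in> facets \<Delta>" "C = - G"
    and i: "i \<in> F" "i \<notin> G" by auto
  have FD: "F \<in> \<Delta>" "G \<in> \<Delta>" using F G by (auto simp: facets_def)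
  then have FiD: "F - {i} \<in> \<Delta>" using M unfolding matroid_complex_def by blast
  have pos: "0 < card F" using i by (auto simp: card_gt_0_iff)
  have "card (F - {i}) < card G"
    using matroid_facets_card[OF M G(1) FD(1)] i pos by simp
  then obtain x where x: "x \<in> G - (F - {i})" "insert x (F - {i}) \<in> \<Delta>"
    using M FD FiD unfolding matroid_complex_def by blast
  \<comment> \<open>\<open>x\<close> differs from \<open>i\<close> because \<open>i\<close> is not
    in \<open>G\<close>.\<close>
  then have xF: "x \<notin> F" "x \<in> G" using i by auto
  then have "card (insert x (F - {i})) = card F" using i pos by simp
  then have "insert x (F - {i}) \<in> facets \<Delta>" using facet_if_card_ge[OF M F(1) x(2)] by simp
  moreover have "insert i (B - {x}) = - insert x (F - {i})" using F i xF by auto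
  ultimately show "\<exists>j\<in>B - C. insert i (B - {j}) \<in> uminus ` facets \<Delta>"
    using F G xF by (intro bexI[of _ x]) auto
qed

lemma facets_nonempty:
  fixes \<Delta> :: "'v::finite set set"
  assumes "matroid_complex \<Delta>"
  shows "facets \<Delta> \<noteq> {}"
proof -
  have "\<Delta> \<noteq> {}" using assms by (auto simp: matroid_complex_def)
  then obtain F where "F \<in> \<Delta>" "\<forall>G\<in>\<Delta>. F \<subseteq> G \<longrightarrow> F = G"
    using finite_has_maximal[of \<Delta>] by auto
  then show ?thesis by (auto simp: facets_def)
qed

theorem theorem5p5:
  fixes \<Delta> :: "('v::finite) set set" and m :: nat
  assumes "matroid_complex \<Delta>" and "m \<ge> 1"
  shows "k_clean 0 (sr_symbolic_power \<Delta> m :: ('v, 'k::field) mpoly set)"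
proof -
  interpret weighted_bases "uminus ` facets \<Delta>" m by (rule weighted_bases_matroid[OF assms(1)])
  \<comment> \<open>The empty \<open>D\<close> has weight zero, so only the inequalities of the
    facet complements remain.\<close>
  have "sr_symbolic_power \<Delta> m = (state_ideal {} 0 :: ('v, 'k) mpoly set)"
    by (auto simp: sr_symbolic_power_def ideal_power_prime_compl monom_span_def state_def wt_def)
  \<comment> \<open>Every basis has weight \<open>0\<close> under \<open>w = 0\<close>, so
    \<open>m \<ge> 1\<close> makes all of them active.\<close>
  moreover have "active {} 0 \<noteq> {}"
    using facets_nonempty[OF assms(1)] assms(2) by (auto simp: active_def)
  ultimately show ?thesis using k_clean_state_ideal by metis
qed

end
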